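(* Let $d\ge3$, $a=d-1$, $n\ge1$, and let $B_n$ be the graph obtained from the ball of radius $n$ around a vertex (the root) in the infinite $d$-regular tree by adding a sink vertex and joining each vertex at distance exactly $n$ from the root to the sink by $d-1$ edges (there is no edge between the root and the sink). Let $p$ be a prime not dividing $d(d-1)$, let $q_k=1+a+\cdots+a^{k-1}$ and let $t_p$ be the least positive integer $k$ with $p\mid q_k$. Let $S_p(n)$ be the Sylow $p$-subgroup of the sandpile group $SP(B_n)$. Then $$\operatorname{rank}S_p(n)=\begin{cases} d(d-2)\displaystyle\sum_{\substack{0\le m<n\\ m\equiv n\ (\mathrm{mod}\ t_p)}}(d-1)^m, & n\not\equiv-1\ (\mathrm{mod}\ t_p),\\[2ex] d(d-2)\displaystyle\sum_{\substack{0\le m<n\\ m\equiv n\ (\mathrm{mod}\ t_p)}}(d-1)^m+d-1, & n\equiv -1\ (\mathrm{mod}\ t_p).\end{cases}$$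
   Context: Sandpile group of a finite graph $G$ with vertex set $V$ and sink $s$: $SP(G)=\mathbb{Z}^V/L$, where $L$ is generated by the indicator vector of $s$ and the vectors $\Delta_x$ ($x\in V$), $\Delta_x$ having entry equal to the number of edges between $x$ and $y$ at $y\neq x$ and $-\deg(x)$ at $x$. The rank of a finite abelian $p$-group is the number of cyclic factors in its decomposition into cyclic groups. (Note $t_p=p$ if $a\equiv1\pmod p$ and $t_p$ is the multiplicative order of $a$ mod $p$ otherwise.) *)

theory Defs
  imports Main "HOL-Computational_Algebra.Primes"
begin

inductive_set zspan :: "('a \<Rightarrow> int) set \<Rightarrow> ('a \<Rightarrow> int) set" for S where
  zspan_zero: "(\<lambda>_. 0) \<in> zspan S"
| zspan_gen: "v \<in> S \<Longrightarrow> v \<in> zspan S"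
| zspan_add: "u \<in> zspan S \<Longrightarrow> v \<in> zspan S \<Longrightarrow> (\<lambda>y. u y + v y) \<in> zspan S"
| zspan_neg: "u \<in> zspan S \<Longrightarrow> (\<lambda>y. - u y) \<in> zspan S"

(* A finite multigraph on vertex set V (no loops), given by an edge multiplicity
   function w (w x y = number of edges between x and y, symmetric). *)
definition mg_deg :: "'a set \<Rightarrow> ('a \<Rightarrow> 'a \<Rightarrow> nat) \<Rightarrow> 'a \<Rightarrow> nat" where
  "mg_deg V w x = (\<Sum>y\<in>V - {x}. w x y)"

definition laplace_vec :: "'a set \<Rightarrow> ('a \<Rightarrow> 'a \<Rightarrow> nat) \<Rightarrow> 'a \<Rightarrow> 'a \<Rightarrow> int" where
  "laplace_vec V w x = (\<lambda>y. if y \<notin> V then 0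
                             else if y = x then - int (mg_deg V w x) else int (w x y))"

definition sandpile_lattice :: "'a set \<Rightarrow> ('a \<Rightarrow> 'a \<Rightarrow> nat) \<Rightarrow> 'a \<Rightarrow> ('a \<Rightarrow> int) set" where
  "sandpile_lattice V w s =
     zspan ({\<lambda>y. if y = s then 1 else 0} \<union> laplace_vec V w ` V)"

definition zvec :: "'a set \<Rightarrow> ('a \<Rightarrow> int) set" where
  "zvec V = {x. \<forall>v. v \<notin> V \<longrightarrow> x v = 0}"

(* SP(G) = Z^V / L.  An element [x] lies in the Sylow p-subgroup iff p^k [x] = 0
   for some k, i.e. p^k x \<in> L.  We record the representatives. *)
definition sylow_reps :: "'a set \<Rightarrow> ('a \<Rightarrow> 'a \<Rightarrow> nat) \<Rightarrow> 'a \<Rightarrow> nat \<Rightarrow> ('a \<Rightarrow> int) set" where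
  "sylow_reps V w s p =
     {x \<in> zvec V. \<exists>k::nat. (\<lambda>y. int p ^ k * x y) \<in> sandpile_lattice V w s}"

(* Rank of the Sylow p-subgroup of SP(G): the number of cyclic factors of this
   finite abelian p-group, i.e. the least number of elements generating it
   (elements of the quotient are given by representatives; equality is modulo L). *)
definition sylow_rank :: "'a set \<Rightarrow> ('a \<Rightarrow> 'a \<Rightarrow> nat) \<Rightarrow> 'a \<Rightarrow> nat \<Rightarrow> nat" where
  "sylow_rank V w s p =
     (LEAST k. \<exists>g :: nat \<Rightarrow> ('a \<Rightarrow> int).
         (\<forall>i<k. g i \<in> sylow_reps V w s p) \<and>
         (\<forall>x\<in>sylow_reps V w s p. \<exists>c :: nat \<Rightarrow> int.
             (\<lambda>y. x y - (\<Sum>i<k. c i * g i y)) \<in> sandpile_lattice V w s))"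

(* The infinite d-regular tree, realised as the Cayley graph of the free product of
   d copies of Z/2: vertices are reduced words over {0..<d} (no two consecutive
   letters equal), root = [], xs adjacent to xs@[i].  Distance to the root = length. *)
definition tree_ball :: "nat \<Rightarrow> nat \<Rightarrow> nat list set" where
  "tree_ball d n = {xs. length xs \<le> n \<and> set xs \<subseteq> {..<d} \<and>
                        (\<forall>i. Suc i < length xs \<longrightarrow> xs ! i \<noteq> xs ! Suc i)}"

definition tree_adj :: "nat list \<Rightarrow> nat list \<Rightarrow> bool" where
  "tree_adj xs ys = ((\<exists>i. ys = xs @ [i]) \<or> (\<exists>i. xs = ys @ [i]))"

definition Bn_verts :: "nat \<Rightarrow> nat \<Rightarrow> nat list option set" where
  "Bn_verts d n = Some ` tree_ball d n \<union> {None}"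

fun Bn_mult :: "nat \<Rightarrow> nat \<Rightarrow> nat list option \<Rightarrow> nat list option \<Rightarrow> nat" where
  "Bn_mult d n (Some xs) (Some ys) = (if tree_adj xs ys then 1 else 0)"
| "Bn_mult d n (Some xs) None = (if length xs = n then d - 1 else 0)"
| "Bn_mult d n None (Some ys) = (if length ys = n then d - 1 else 0)"
| "Bn_mult d n None None = 0"

definition qk :: "nat \<Rightarrow> nat \<Rightarrow> nat" where
  "qk a k = (\<Sum>i<k. a ^ i)"

definition t_p :: "nat \<Rightarrow> nat \<Rightarrow> nat" where
  "t_p a p = (LEAST k. 0 < k \<and> p dvd qk a k)"

end

(* The rank of the Sylow p-subgroup is the dimension of SP(B_n) / p SP(B_n) over the field with p
   elements. Working inwards from the leaves, the relations give q_j e_u = q_(j+1) e_v in SP(B_n)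
   for a vertex u of height j = n - |u| and a child v of u, and d a^n e_[] = 0 at the root. Hence,
   modulo p, e_[] vanishes and e_v is a multiple of e_u unless p | q_(j+1). If p | q_(j+1), the
   relation at u expresses one child of u by the others, its parent and u itself. So the remaining
   children of such vertices u generate, and they are independent because there are harmonic
   functions modulo p with arbitrary values on them. Counting them by distance l = |u| from the root,
   with p | q_k iff t_p | k, gives the formula: l = 0 contributes d - 1, and l = m + 1 contributes
   d (d - 2) (d - 1)^m. *)

theory Submission
  imports Defs "HOL-Number_Theory.Residues"
begin

section \<open>Subgroups of integer-valued functions\<close>

text \<open>Closure under two-term combinations packs sum, difference and multiple into one
  condition. The notion is kept apart from \<open>zspan\<close> so that the same rules serve the
  lattice itself, \<open>torsion_over\<close> and \<open>mod_gen\<close>.\<close>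

definition int_subgroup :: "('a \<Rightarrow> int) set \<Rightarrow> bool" where
  "int_subgroup H \<longleftrightarrow> (\<lambda>_. 0) \<in> H \<and>
     (\<forall>u\<in>H. \<forall>v\<in>H. \<forall>a b. (\<lambda>y. a * u y + b * v y) \<in> H)"

lemma int_subgroup_comb:
  assumes "int_subgroup H" "u \<in> H" "v \<in> H" "\<And>y. w y = a * u y + b * v y"
  shows "w \<in> H"
proof -
  have "w = (\<lambda>y. a * u y + b * v y)" using assms(4) by auto
  then show ?thesis using assms(1-3) unfolding int_subgroup_def by blast
qed

lemma int_subgroup_zero: "int_subgroup H \<Longrightarrow> (\<lambda>_. 0) \<in> H"
  by (simp add: int_subgroup_def)

lemma int_subgroup_scale:
  "int_subgroup H \<Longrightarrow> u \<in> H \<Longrightarrow> (\<And>y. w y = a * u y) \<Longrightarrow> w \<in> H"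
  by (rule int_subgroup_comb[of H u u w a 0]) auto

lemma int_subgroup_sum:
  assumes "int_subgroup H" "\<And>i. i \<in> A \<Longrightarrow> f i \<in> H"
  shows "(\<lambda>y. \<Sum>i\<in>A. f i y) \<in> H"
  using assms(2)
proof (induction A rule: infinite_finite_induct)
  case (insert x A)
  then show ?case
    by - (rule int_subgroup_comb[OF assms(1), of "f x" "\<lambda>y. \<Sum>i\<in>A. f i y" _ 1 1], auto)
qed (auto intro: int_subgroup_zero assms(1))

lemma zspan_scale:
  assumes "v \<in> zspan S" shows "(\<lambda>y. c * v y) \<in> zspan S"
proof -
  have nat: "(\<lambda>y. int k * v y) \<in> zspan S" for k
  proof (induction k)
    case (Suc k)
    from zspan_add[OF Suc assms] show ?case by (simp add: algebra_simps)
  qed (simp add: zspan_zero)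
  show ?thesis
  proof (cases "c \<ge> 0")
    case True
    then show ?thesis using nat[of "nat c"] by simp
  next
    case False
    then show ?thesis using zspan_neg[OF nat[of "nat (- c)"]] by simp
  qed
qed

lemma int_subgroup_zspan: "int_subgroup (zspan S)"
  unfolding int_subgroup_def by (auto intro: zspan_zero zspan_add zspan_scale)

text \<open>A Bezout identity \<open>r * a + s * b = 1\<close> writes \<open>x\<close> as a
  combination of its two multiples.\<close>

lemma int_subgroup_coprime:
  assumes "int_subgroup H" "(\<lambda>y. a * x y) \<in> H" "(\<lambda>y. b * x y) \<in> H" "coprime a (b::int)"
  shows "x \<in> H"
proof -
  obtain r s where "r * a + s * b = 1"
    using assms(4) by (metis bezout_int coprime_iff_gcd_eq_1)
  then have "(r * a + s * b) * x y = x y" for y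
    by simp
  then have "x y = r * (a * x y) + s * (b * x y)" for y
    by (simp add: algebra_simps)
  then show ?thesis by (rule int_subgroup_comb[OF assms(1-3)])
qed

section \<open>Coordinate vectors\<close>

definition unit_at :: "'a \<Rightarrow> 'a \<Rightarrow> int" where
  "unit_at v = (\<lambda>y. if y = v then 1 else 0)"

lemma sum_mult_unit_at:
  assumes "finite V" "v \<in> V" shows "(\<Sum>y\<in>V. f y * unit_at v y) = f v"
proof -
  have "(\<Sum>y\<in>V. f y * unit_at v y) = (\<Sum>y\<in>V. if y = v then f y else 0)"
    by (intro sum.cong) (auto simp: unit_at_def)
  then show ?thesis using assms by simp
qed

lemma sum_unit_at:
  assumes "finite A" shows "(\<Sum>v\<in>A. f v * unit_at v y) = (if y \<in> A then f y else 0)"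
proof -
  have "(\<Sum>v\<in>A. f v * unit_at v y) = (\<Sum>v\<in>A. if v = y then f v else 0)"
    by (intro sum.cong) (auto simp: unit_at_def)
  then show ?thesis using assms by simp
qed

lemma zvec_eq_sum_unit_at:
  "finite V \<Longrightarrow> x \<in> zvec V \<Longrightarrow> x y = (\<Sum>v\<in>V. x v * unit_at v y)"
  by (auto simp: sum_unit_at zvec_def)

section \<open>Elements of finite order modulo a subgroup\<close>

definition torsion_over :: "('a \<Rightarrow> int) set \<Rightarrow> ('a \<Rightarrow> int) set" where
  "torsion_over H = {x. \<exists>M>0. (\<lambda>y. M * x y) \<in> H}"

lemma int_subgroup_torsion_over:
  assumes "int_subgroup H" shows "int_subgroup (torsion_over H)"
proof -
  have "(\<lambda>y. a * u y + b * v y) \<in> torsion_over H"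
    if u: "u \<in> torsion_over H" and v: "v \<in> torsion_over H" for u v a b
  proof -
    obtain M N where MN: "M > 0" "N > 0" "(\<lambda>y. M * u y) \<in> H" "(\<lambda>y. N * v y) \<in> H"
      using u v unfolding torsion_over_def by blast
    have "(\<lambda>y. M * N * (a * u y + b * v y)) \<in> H"
      by (rule int_subgroup_comb[OF assms MN(3,4), of _ "N * a" "M * b"]) (simp add: algebra_simps)
    then show ?thesis unfolding torsion_over_def using MN(1,2) by (auto intro!: exI[of _ "M * N"])
  qed
  moreover have "(\<lambda>_. 0) \<in> torsion_over H"
    unfolding torsion_over_def using int_subgroup_zero[OF assms] by (auto intro!: exI[of _ 1])
  ultimately show ?thesis unfolding int_subgroup_def by blast
qed

lemma subset_torsion_over: "H \<subseteq> torsion_over H"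
  unfolding torsion_over_def by (auto intro!: exI[of _ 1])

lemma torsion_over_cancel:
  assumes "int_subgroup H" "(\<lambda>y. m * x y) \<in> torsion_over H" "m \<noteq> 0"
  shows "x \<in> torsion_over H"
proof -
  obtain M where "M > 0" "(\<lambda>y. M * (m * x y)) \<in> H"
    using assms(2) unfolding torsion_over_def by blast
  \<comment> \<open>Exponents have to be positive, so the sign of \<open>m\<close> is absorbed by
    the factor \<open>sgn m\<close>.\<close>
  then have "(\<lambda>y. (M * \<bar>m\<bar>) * x y) \<in> H"
    by - (rule int_subgroup_scale[OF assms(1), of "\<lambda>y. M * (m * x y)" _ "sgn m"],
          auto simp: algebra_simps abs_sgn)
  then show ?thesis unfolding torsion_over_def using \<open>M > 0\<close> \<open>m \<noteq> 0\<close>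
    by (auto intro!: exI[of _ "M * \<bar>m\<bar>"])
qed

text \<open>The product of the exponents of the coordinate vectors annihilates all of them, hence
  all their integer combinations. So the quotient of \<open>zvec V\<close> has finite
  exponent.\<close>

lemma common_torsion_exponent:
  assumes "int_subgroup H" "finite V" "\<And>v. v \<in> V \<Longrightarrow> unit_at v \<in> torsion_over H"
  shows "\<exists>M>0. \<forall>x\<in>zvec V. (\<lambda>y. M * x y) \<in> H"
proof -
  obtain N where N: "\<And>v. v \<in> V \<Longrightarrow> N v > 0 \<and> (\<lambda>y. N v * unit_at v y) \<in> H"
    using assms(3) unfolding torsion_over_def by (auto, metis)
  define M where "M = (\<Prod>v\<in>V. N v)"
  have M: "(\<lambda>y. M * unit_at v y) \<in> H" if "v \<in> V" for v
  proof -
    have "M = (\<Prod>u\<in>V - {v}. N u) * N v"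
      unfolding M_def using assms(2) that by (simp add: prod.remove mult.commute)
    then show ?thesis
      by - (rule int_subgroup_scale[OF assms(1) conjunct2[OF N[OF that]], of _ "\<Prod>u\<in>V - {v}. N u"],
            simp add: mult.assoc)
  qed
  have "(\<lambda>y. M * x y) \<in> H" if x: "x \<in> zvec V" for x
  proof -
    have "(\<lambda>y. \<Sum>v\<in>V. x v * (M * unit_at v y)) \<in> H"
    proof (rule int_subgroup_sum[OF assms(1)])
      show "(\<lambda>y. x v * (M * unit_at v y)) \<in> H" if "v \<in> V" for v
        by (rule int_subgroup_scale[OF assms(1) M[OF that], of _ "x v"]) simp
    qed
    moreover have "(\<Sum>v\<in>V. x v * (M * unit_at v y)) = M * x y" for y
      unfolding zvec_eq_sum_unit_at[OF assms(2) x, of y] sum_distrib_left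
      by (intro sum.cong) auto
    ultimately show ?thesis by simp
  qed
  moreover have "M > 0" unfolding M_def using N by (simp add: prod_pos)
  ultimately show ?thesis by blast
qed

section \<open>Generation modulo a prime\<close>

text \<open>This is the preimage of the span of the vectors \<open>unit_at g\<close> in the quotient
  by \<open>H\<close> and by the multiples of \<open>p\<close>. The support of \<open>z\<close> is
  left free here; it is recovered in \<open>generates_modulo_power\<close>.\<close>

definition mod_gen :: "int \<Rightarrow> 'a set \<Rightarrow> ('a \<Rightarrow> int) set \<Rightarrow> ('a \<Rightarrow> int) set" where
  "mod_gen p G H = {x. \<exists>c z. (\<lambda>y. x y - (\<Sum>g\<in>G. c g * unit_at g y) - p * z y) \<in> H}"

lemma int_subgroup_mod_gen:
  assumes "int_subgroup H" shows "int_subgroup (mod_gen p G H)"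
proof -
  have "(\<lambda>y. a * u y + b * v y) \<in> mod_gen p G H"
    if u: "u \<in> mod_gen p G H" and v: "v \<in> mod_gen p G H" for u v a b
  proof -
    obtain c z where 1: "(\<lambda>y. u y - (\<Sum>g\<in>G. c g * unit_at g y) - p * z y) \<in> H"
      using u unfolding mod_gen_def by blast
    obtain c' z' where 2: "(\<lambda>y. v y - (\<Sum>g\<in>G. c' g * unit_at g y) - p * z' y) \<in> H"
      using v unfolding mod_gen_def by blast
    have "(\<lambda>y. a * u y + b * v y - (\<Sum>g\<in>G. (a * c g + b * c' g) * unit_at g y)
              - p * (a * z y + b * z' y)) \<in> H"
      by (rule int_subgroup_comb[OF assms 1 2, of _ a b])
         (simp add: algebra_simps sum.distrib sum_distrib_left)
    then show ?thesis unfolding mod_gen_def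
      by (intro CollectI exI[of _ "\<lambda>g. a * c g + b * c' g"] exI[of _ "\<lambda>y. a * z y + b * z' y"])
  qed
  moreover have "(\<lambda>_. 0) \<in> mod_gen p G H"
    unfolding mod_gen_def using int_subgroup_zero[OF assms]
    by (intro CollectI exI[of _ "\<lambda>_. 0"]) simp
  ultimately show ?thesis unfolding int_subgroup_def by blast
qed

lemma subset_mod_gen: "H \<subseteq> mod_gen p G H"
proof
  fix x assume "x \<in> H"
  then show "x \<in> mod_gen p G H" unfolding mod_gen_def
    by (intro CollectI exI[of _ "\<lambda>_. 0"]) simp
qed

lemma mult_mem_mod_gen:
  assumes "int_subgroup H" shows "(\<lambda>y. p * x y) \<in> mod_gen p G H"
  unfolding mod_gen_def using int_subgroup_zero[OF assms]
  by (intro CollectI exI[of _ "\<lambda>_. 0"] exI[of _ x]) simp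

lemma unit_at_mem_mod_gen:
  assumes "int_subgroup H" "finite G" "v \<in> G" shows "unit_at v \<in> mod_gen p G H"
proof -
  have "(\<lambda>y. unit_at v y - (\<Sum>g\<in>G. unit_at v g * unit_at g y) - p * 0) = (\<lambda>_. 0)"
    using assms(3) by (simp add: sum_unit_at[OF assms(2)]) (auto simp: unit_at_def fun_eq_iff)
  then have "(\<lambda>y. unit_at v y - (\<Sum>g\<in>G. unit_at v g * unit_at g y) - p * 0) \<in> H"
    using int_subgroup_zero[OF assms(1)] by (simp only:)
  then show ?thesis unfolding mod_gen_def
    by (intro CollectI) (rule exI[of _ "unit_at v"], rule exI[of _ "\<lambda>_. 0"])
qed

text \<open>A multiplier coprime to \<open>p\<close> is invertible modulo \<open>p\<close>, and
  \<open>p * x\<close> always belongs to \<open>mod_gen p G H\<close>.\<close>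

lemma mod_gen_cancel:
  assumes "int_subgroup H" "(\<lambda>y. m * x y) \<in> mod_gen p G H" "coprime m p"
  shows "x \<in> mod_gen p G H"
  by (rule int_subgroup_coprime[OF int_subgroup_mod_gen[OF assms(1)] assms(2)
        mult_mem_mod_gen[OF assms(1)] assms(3)])


section \<open>The rank of the Sylow subgroup\<close>

lemma int_subgroup_sandpile_lattice: "int_subgroup (sandpile_lattice V w s)"
  unfolding sandpile_lattice_def by (rule int_subgroup_zspan)

lemma unit_at_zvec: "v \<in> V \<Longrightarrow> unit_at v \<in> zvec V"
  by (auto simp: zvec_def unit_at_def)

lemma sandpile_lattice_subset_zvec:
  assumes "s \<in> V" shows "sandpile_lattice V w s \<subseteq> zvec V"
proof
  fix x assume "x \<in> sandpile_lattice V w s"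
  then show "x \<in> zvec V" unfolding sandpile_lattice_def
    by (induction rule: zspan.induct) (use assms in \<open>auto simp: zvec_def laplace_vec_def\<close>)
qed

text \<open>Divisibility of a pairing passes from the generators to their span. In this way a
  function that is harmonic modulo \<open>m\<close> and vanishes at the sink modulo \<open>m\<close>
  defines a homomorphism from the sandpile group to the integers modulo \<open>m\<close>.\<close>

lemma sandpile_lattice_pairing:
  fixes \<phi> :: "'a \<Rightarrow> int"
  assumes "\<And>v. v \<in> V \<Longrightarrow> m dvd (\<Sum>y\<in>V. \<phi> y * laplace_vec V w v y)"
    and "m dvd (\<Sum>y\<in>V. \<phi> y * unit_at s y)"
    and "x \<in> sandpile_lattice V w s"
  shows "m dvd (\<Sum>y\<in>V. \<phi> y * x y)"
  using assms(3) unfolding sandpile_lattice_def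
proof (induction rule: zspan.induct)
  case (zspan_gen v)
  then show ?case using assms(1,2) by (auto simp: unit_at_def)
qed (simp_all add: distrib_left sum.distrib sum_negf)

text \<open>The iteration behind Nakayama's lemma: the remainder \<open>z\<close> is itself
  generated modulo \<open>p\<close>, and substituting its expression raises the precision from
  \<open>p ^ j\<close> to \<open>p ^ Suc j\<close>.\<close>

lemma generates_modulo_power:
  assumes "int_subgroup H" "finite V" "G \<subseteq> V" "H \<subseteq> zvec V" "p \<noteq> 0"
    and gen: "\<And>v. v \<in> V \<Longrightarrow> unit_at v \<in> mod_gen p G H"
    and x: "x \<in> zvec V"
  shows "\<exists>c. \<exists>z\<in>zvec V. (\<lambda>y. x y - (\<Sum>g\<in>G. c g * unit_at g y) - p ^ j * z y) \<in> H"
proof (induction j)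
  case 0
  show ?case using int_subgroup_zero[OF assms(1)] x by (intro exI[of _ "\<lambda>_. 0"] bexI[of _ x]) simp_all
next
  case (Suc j)
  then obtain c z where z: "z \<in> zvec V"
    and 1: "(\<lambda>y. x y - (\<Sum>g\<in>G. c g * unit_at g y) - p ^ j * z y) \<in> H" by blast
  have "(\<lambda>y. \<Sum>v\<in>V. z v * unit_at v y) \<in> mod_gen p G H"
  proof (rule int_subgroup_sum[OF int_subgroup_mod_gen[OF assms(1)]])
    show "(\<lambda>y. z v * unit_at v y) \<in> mod_gen p G H" if "v \<in> V" for v
      by (rule int_subgroup_scale[OF int_subgroup_mod_gen[OF assms(1)] gen[OF that], of _ "z v"]) simp
  qed
  moreover have "(\<lambda>y. \<Sum>v\<in>V. z v * unit_at v y) = z"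
    by (rule ext) (rule zvec_eq_sum_unit_at[OF assms(2) z, symmetric])
  ultimately have "z \<in> mod_gen p G H" by (simp only:)
  then obtain c' z' where 2: "(\<lambda>y. z y - (\<Sum>g\<in>G. c' g * unit_at g y) - p * z' y) \<in> H"
    unfolding mod_gen_def by blast
  \<comment> \<open>Outside \<open>V\<close> all other terms of the relation vanish, so
    \<open>p * z'\<close> vanishes there as well.\<close>
  have "z' \<in> zvec V"
  proof -
    have "z' y = 0" if "y \<notin> V" for y
    proof -
      have "z y - (\<Sum>g\<in>G. c' g * unit_at g y) - p * z' y = 0"
        using 2 assms(4) that unfolding zvec_def by blast
      moreover have "(\<Sum>g\<in>G. c' g * unit_at g y) = 0"
        using that assms(3) by (intro sum.neutral) (auto simp: unit_at_def)
      moreover have "z y = 0" using z that by (simp add: zvec_def)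
      ultimately show ?thesis using assms(5) by simp
    qed
    then show ?thesis by (simp add: zvec_def)
  qed
  moreover have "(\<lambda>y. x y - (\<Sum>g\<in>G. (c g + p ^ j * c' g) * unit_at g y) - p ^ Suc j * z' y) \<in> H"
    by (rule int_subgroup_comb[OF assms(1) 1 2, of _ 1 "p ^ j"])
       (simp add: algebra_simps sum.distrib sum_distrib_left)
  ultimately show ?case by (intro exI[of _ "\<lambda>g. c g + p ^ j * c' g"] bexI[of _ z'])
qed

text \<open>The hypothesis \<open>gen\<close> bounds the rank from above by Nakayama's lemma. The functionals in
  \<open>dual\<close> bound it from below: modulo \<open>p\<close> there are at least \<open>p ^ card G\<close> of them, and each is
  determined on the Sylow subgroup by its values on a generating set.\<close>

theorem sylow_rank_eq_card:
  fixes V :: "'a set" and w s p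
  defines "L \<equiv> sandpile_lattice V w s"
  assumes V: "finite V" "s \<in> V" and p: "prime p" and G: "G \<subseteq> V"
    and tors: "\<And>v. v \<in> V \<Longrightarrow> unit_at v \<in> torsion_over L"
    and gen: "\<And>v. v \<in> V \<Longrightarrow> unit_at v \<in> mod_gen (int p) G L"
    and dual: "\<And>b :: 'a \<Rightarrow> int. \<exists>\<phi> :: 'a \<Rightarrow> int. (\<forall>x\<in>L. int p dvd (\<Sum>y\<in>V. \<phi> y * x y)) \<and>
                 (\<forall>g\<in>G. \<phi> g = b g)"
  shows "sylow_rank V w s p = card G"
proof -
  have L: "int_subgroup L" unfolding L_def by (rule int_subgroup_sandpile_lattice)
  have LV: "L \<subseteq> zvec V" unfolding L_def by (rule sandpile_lattice_subset_zvec[OF V(2)])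
  have fG: "finite G" using V(1) G finite_subset by blast
  have pi: "prime (int p)" using p by simp
  obtain M where M: "M > 0" "\<And>x. x \<in> zvec V \<Longrightarrow> (\<lambda>y. M * x y) \<in> L"
    using common_torsion_exponent[OF L V(1) tors] by blast
  \<comment> \<open>The exponent is split into a power of \<open>p\<close> and a part
    \<open>m\<close> prime to \<open>p\<close>. Multiplication by \<open>m\<close> maps the whole
    group onto its Sylow \<open>p\<close>-subgroup, so the multiples of the coordinate vectors by
    \<open>m\<close> are the candidates for generators.\<close>
  obtain m where m: "M = int p ^ multiplicity (int p) M * m" "\<not> int p dvd m"
  proof (rule multiplicity_decompose'[of M "int p"])
    show "M \<noteq> 0" using M(1) by simp
    show "\<not> is_unit (int p)" using pi by (auto simp: not_prime_1)
  qed
  define e where "e = multiplicity (int p) M"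
  have Me: "M = int p ^ e * m" using m(1) e_def by simp
  have cop: "coprime (int p) m" using m(2) pi by (simp add: prime_imp_coprime)
  have syl: "sylow_reps V w s p = {x \<in> zvec V. \<exists>k. (\<lambda>y. int p ^ k * x y) \<in> L}"
    unfolding sylow_reps_def L_def ..
  have mG: "(\<lambda>y. m * unit_at g y) \<in> sylow_reps V w s p" if "g \<in> G" for g
  proof -
    have "unit_at g \<in> zvec V" by (rule unit_at_zvec[OF subsetD[OF G that]])
    moreover from M(2)[OF this] have "(\<lambda>y. int p ^ e * (m * unit_at g y)) \<in> L"
      by (simp add: Me mult.assoc)
    moreover have "(\<lambda>y. m * unit_at g y) \<in> zvec V"
      using calculation(1) by (simp add: zvec_def)
    ultimately show ?thesis unfolding syl by blast
  qed
  obtain \<beta> where \<beta>: "bij_betw \<beta> {..<card G} G"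
    using fG ex_bij_betw_nat_finite[OF fG] by (auto simp: atLeast0LessThan)
  let ?gens = "\<lambda>k g. (\<forall>i<k. g i \<in> sylow_reps V w s p) \<and>
      (\<forall>x\<in>sylow_reps V w s p. \<exists>c :: nat \<Rightarrow> int. (\<lambda>y. x y - (\<Sum>i<k. c i * g i y)) \<in> L)"
  define g where "g = (\<lambda>i y. m * unit_at (\<beta> i) y)"
  have "?gens (card G) g"
  proof (intro conjI allI impI ballI)
    fix i assume "i < card G"
    then show "g i \<in> sylow_reps V w s p"
      unfolding g_def by (intro mG bij_betwE[OF \<beta>, rule_format]) simp
  next
    fix x assume "x \<in> sylow_reps V w s p"
    then obtain k where xV: "x \<in> zvec V" and xk: "(\<lambda>y. int p ^ k * x y) \<in> L" unfolding syl by blast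
    obtain c z where z: "z \<in> zvec V"
      and 1: "(\<lambda>y. x y - (\<Sum>g\<in>G. c g * unit_at g y) - int p ^ e * z y) \<in> L"
      using generates_modulo_power[OF L V(1) G LV _ gen xV, of e] p by (auto simp: prime_gt_0_nat)
    \<comment> \<open>The generators carry a factor \<open>m\<close>, so the coefficients
      \<open>c\<close> are corrected by \<open>r\<close>, an inverse of \<open>m\<close> modulo
      \<open>p ^ e\<close>.\<close>
    obtain r t where rt: "r * m + t * int p ^ e = 1"
    proof -
      have "gcd m (int p ^ e) = 1"
        using cop by (simp add: coprime_commute flip: coprime_iff_gcd_eq_1)
      then show ?thesis using bezout_int[of m "int p ^ e"] that by auto
    qed
    define u where "u = (\<lambda>y. x y - (\<Sum>i<card G. (r * c (\<beta> i)) * g i y))"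
    have ueq: "u y = x y - r * m * (\<Sum>g\<in>G. c g * unit_at g y)" for y
    proof -
      have "(\<Sum>i<card G. (r * c (\<beta> i)) * g i y) = (\<Sum>i<card G. r * m * (c (\<beta> i) * unit_at (\<beta> i) y))"
        unfolding g_def by (simp add: algebra_simps)
      also have "\<dots> = r * m * (\<Sum>g\<in>G. c g * unit_at g y)"
        unfolding sum_distrib_left
        by (rule sum.reindex_bij_betw[OF \<beta>, of "\<lambda>g. r * m * (c g * unit_at g y)"])
      finally show ?thesis unfolding u_def by simp
    qed
    have sGV: "(\<lambda>y. \<Sum>g\<in>G. c g * unit_at g y) \<in> zvec V"
      unfolding zvec_def using G by (auto simp: sum_unit_at[OF fG])
    \<comment> \<open>The factor \<open>m\<close> kills the remainder \<open>p ^ e * z\<close>,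
      since \<open>m * p ^ e = M\<close>. Replacing \<open>r * m\<close> by 1 changes the sum by a
      multiple of \<open>p ^ e\<close>, which is killed in the same way.\<close>
    have mu: "(\<lambda>y. m * u y) \<in> L"
    proof -
      have mz: "(\<lambda>y. m * (int p ^ e * z y)) \<in> L"
        using M(2)[OF z] by (simp add: Me algebra_simps)
      have ms: "(\<lambda>y. m * (int p ^ e * (\<Sum>g\<in>G. c g * unit_at g y))) \<in> L"
        using M(2)[OF sGV] by (simp add: Me algebra_simps)
      have a: "(\<lambda>y. m * (x y - (\<Sum>g\<in>G. c g * unit_at g y))) \<in> L"
        by (rule int_subgroup_comb[OF L 1 mz, of _ m 1]) (simp add: algebra_simps)
      have "m * u y = 1 * (m * (x y - (\<Sum>g\<in>G. c g * unit_at g y)))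
          + t * (m * (int p ^ e * (\<Sum>g\<in>G. c g * unit_at g y)))" for y
      proof -
        have "m * ((r * m + t * int p ^ e) * (\<Sum>g\<in>G. c g * unit_at g y))
            = m * (\<Sum>g\<in>G. c g * unit_at g y)" unfolding rt by simp
        then show ?thesis unfolding ueq by (simp add: algebra_simps)
      qed
      then show ?thesis by (rule int_subgroup_comb[OF L a ms])
    qed
    have pu: "(\<lambda>y. int p ^ (k + e) * u y) \<in> L"
    proof -
      have ps: "(\<lambda>y. int p ^ e * (m * (\<Sum>g\<in>G. c g * unit_at g y))) \<in> L"
        using M(2)[OF sGV] by (simp add: Me mult.assoc)
      show ?thesis
        by (rule int_subgroup_comb[OF L xk ps, of _ "int p ^ e" "- r * int p ^ k"])
           (simp add: ueq algebra_simps power_add)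
    qed
    have "u \<in> L"
      by (rule int_subgroup_coprime[OF L mu pu]) (use cop in \<open>simp add: coprime_commute\<close>)
    then show "\<exists>c. (\<lambda>y. x y - (\<Sum>i<card G. c i * g i y)) \<in> L" unfolding u_def
      by (intro exI[of _ "\<lambda>i. r * c (\<beta> i)"])
  qed
  moreover have "card G \<le> k" if gk: "?gens k h" for k h
  proof (rule ccontr)
    assume "\<not> card G \<le> k"
    then have lt: "k < card G" by simp
    obtain \<Phi> :: "('a \<Rightarrow> int) \<Rightarrow> 'a \<Rightarrow> int" where
      \<Phi>L: "\<And>b x. x \<in> L \<Longrightarrow> int p dvd (\<Sum>y\<in>V. \<Phi> b y * x y)" and
      \<Phi>G: "\<And>b g. g \<in> G \<Longrightarrow> \<Phi> b g = b g"
      using dual by metis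
    \<comment> \<open>\<open>\<sigma> b\<close> records the values modulo \<open>p\<close> of the
      functional of \<open>b\<close> on the \<open>k\<close> supposed generators. There are
      \<open>p ^ k\<close> records but \<open>p ^ card G\<close> choices of \<open>b\<close>, so two
      choices collide.\<close>
    define \<sigma> where "\<sigma> = (\<lambda>b. restrict (\<lambda>i. (\<Sum>y\<in>V. \<Phi> b y * h i y) mod int p) {..<k})"
    let ?B = "PiE G (\<lambda>_. {0..<int p})" and ?C = "PiE {..<k} (\<lambda>_. {0..<int p})"
    have "card ?C < card ?B"
      using lt fG prime_gt_1_nat[OF p] by (simp add: card_PiE)
    moreover have "\<sigma> ` ?B \<subseteq> ?C"
      unfolding \<sigma>_def using prime_gt_0_nat[OF p] by (intro image_subsetI) (simp add: restrict_PiE_iff)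
    moreover have "finite ?C" by (intro finite_PiE) auto
    ultimately have "\<not> inj_on \<sigma> ?B" by (meson card_inj_on_le not_le)
    then obtain b b' where b: "b \<in> ?B" "b' \<in> ?B" "b \<noteq> b'" "\<sigma> b = \<sigma> b'"
      unfolding inj_on_def by blast
    define \<psi> where "\<psi> = (\<lambda>x. \<Sum>y\<in>V. (\<Phi> b y - \<Phi> b' y) * x y)"
    have \<psi>: "\<psi> x = (\<Sum>y\<in>V. \<Phi> b y * x y) - (\<Sum>y\<in>V. \<Phi> b' y * x y)" for x
      unfolding \<psi>_def by (simp add: left_diff_distrib sum_subtractf)
    have \<psi>L: "int p dvd \<psi> x" if "x \<in> L" for x
      unfolding \<psi> using \<Phi>L[OF that] by (simp add: dvd_diff)
    have \<psi>h: "int p dvd \<psi> (h i)" if "i < k" for i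
    proof -
      have "\<sigma> b i = \<sigma> b' i" using b(4) by simp
      then show ?thesis using that unfolding \<psi> \<sigma>_def by (simp add: mod_eq_dvd_iff)
    qed
    \<comment> \<open>The difference \<open>\<psi>\<close> vanishes modulo \<open>p\<close> on
      \<open>L\<close> and on every \<open>h i\<close>, hence on \<open>m\<close> times the
      coordinate vector of \<open>g\<close>. As \<open>m\<close> is invertible modulo
      \<open>p\<close>, \<open>b\<close> and \<open>b'\<close> agree at \<open>g\<close>.\<close>
    have "b g = b' g" if g: "g \<in> G" for g
    proof -
      obtain c where c: "(\<lambda>y. m * unit_at g y - (\<Sum>i<k. c i * h i y)) \<in> L"
        using bspec[OF conjunct2[OF gk] mG[OF g]] by blast
      have "\<psi> (\<lambda>y. m * unit_at g y - (\<Sum>i<k. c i * h i y))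
          = m * (b g - b' g) - (\<Sum>i<k. c i * \<psi> (h i))"
      proof -
        have "\<psi> (\<lambda>y. m * unit_at g y - (\<Sum>i<k. c i * h i y))
            = m * (\<Sum>y\<in>V. (\<Phi> b y - \<Phi> b' y) * unit_at g y)
              - (\<Sum>y\<in>V. \<Sum>i<k. c i * ((\<Phi> b y - \<Phi> b' y) * h i y))"
          unfolding \<psi>_def by (simp add: algebra_simps sum_subtractf sum_distrib_left sum.distrib)
        also have "(\<Sum>y\<in>V. \<Sum>i<k. c i * ((\<Phi> b y - \<Phi> b' y) * h i y)) = (\<Sum>i<k. c i * \<psi> (h i))"
          unfolding \<psi>_def sum_distrib_left by (rule sum.swap)
        also have "(\<Sum>y\<in>V. (\<Phi> b y - \<Phi> b' y) * unit_at g y) = b g - b' g"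
          using sum_mult_unit_at[OF V(1), of g] g G \<Phi>G[OF g] by (auto simp: subset_iff)
        finally show ?thesis .
      qed
      moreover have "int p dvd (\<Sum>i<k. c i * \<psi> (h i))"
        by (intro dvd_sum dvd_mult) (auto intro: \<psi>h)
      ultimately have "int p dvd m * (b g - b' g)"
        using \<psi>L[OF c] by (metis diff_add_cancel dvd_add)
      then have "int p dvd b g - b' g" using cop coprime_dvd_mult_right_iff by blast
      then have "b g mod int p = b' g mod int p" by (simp add: mod_eq_dvd_iff)
      moreover have "b g \<in> {0..<int p}" "b' g \<in> {0..<int p}" using b(1,2) g by auto
      ultimately show ?thesis by simp
    qed
    then have "b = b'" using b(1,2) by (intro PiE_ext)
    then show False using b(3) by simp
  qed
  ultimately show ?thesis
    unfolding sylow_rank_def L_def[symmetric] by (intro Least_equality) blast+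
qed

section \<open>The divisibility sequence \<open>q\<^sub>k\<close>\<close>

lemma qk_Suc: "qk a (Suc k) = qk a k + a ^ k"
  by (simp add: qk_def)

lemma qk_Suc': "qk a (Suc k) = 1 + a * qk a k"
  unfolding qk_def sum.lessThan_Suc_shift by (simp add: sum_distrib_left)

lemma qk_0 [simp]: "qk a 0 = 0" and qk_1 [simp]: "qk a (Suc 0) = 1"
  by (simp_all add: qk_def)

lemma qk_add: "qk a (i + j) = qk a i + a ^ i * qk a j"
  by (induction j) (simp_all add: qk_Suc power_add algebra_simps)

text \<open>The form matches a vertex of degree \<open>Suc a\<close> with one parent and
  \<open>a\<close> children: this identity drives both the elimination in the group and the
  construction of harmonic functions.\<close>

lemma qk_recurrence:
  "int (Suc a) * int (qk a (Suc k)) = int a * int (qk a k) + int (qk a (Suc (Suc k)))"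
  by (simp add: qk_Suc' algebra_simps)

text \<open>Consecutive terms are coprime because
  \<open>qk a (Suc k) = 1 + a * qk a k\<close>.\<close>

lemma not_dvd_qk_Suc:
  assumes "prime p" "p dvd qk a k" shows "\<not> p dvd qk a (Suc k)"
  using assms prime_gt_1_nat[OF assms(1)]
  by (metis qk_Suc' dvd_add_left_iff dvd_mult nat_dvd_1_iff_1 less_irrefl)

text \<open>Since \<open>(a - 1) * qk a k = a ^ k - 1\<close>, Euler's theorem applies. The modulus
  \<open>p * (a - 1)\<close> in place of \<open>p\<close> allows the factor \<open>a - 1\<close> to
  be cancelled even when \<open>p\<close> divides it.\<close>

lemma ex_dvd_qk:
  assumes "coprime a p" "a \<ge> 2" "p > 0"
  shows "\<exists>k>0. p dvd qk a k"
proof -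
  let ?m = "p * (a - 1)"
  have "coprime a (a - 1)" 
    using assms(2) coprime_diff_one_left_nat[of a] by (simp add: coprime_commute)
  then have "coprime a ?m" using assms(1) by simp
  then have "[a ^ totient ?m = 1] (mod ?m)" by (rule euler_theorem)
  moreover have "a ^ k = 1 + (a - 1) * qk a k" for k
  proof -
    obtain b where "a = Suc b" using assms(2) by (cases a) auto
    then show ?thesis by (induction k) (simp_all add: qk_Suc algebra_simps)
  qed
  ultimately have "[1 + (a - 1) * qk a (totient ?m) = 1 + 0] (mod ?m)" by simp
  then have "?m dvd (a - 1) * qk a (totient ?m)"
    by (simp only: cong_add_lcancel_nat cong_0_iff)
  then have "p dvd qk a (totient ?m)" using assms(2) by (simp add: mult.commute)
  moreover have "totient ?m > 0" using assms by simp
  ultimately show ?thesis by blast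
qed

text \<open>By \<open>qk_add\<close>, multiples of \<open>t_p a p\<close> can be removed from the
  index without changing divisibility by \<open>p\<close>; minimality of \<open>t_p a p\<close> then
  excludes nonzero residues.\<close>

lemma dvd_qk_iff_t_p_dvd:
  assumes "coprime a p" "a \<ge> 2" "p > 0"
  shows "p dvd qk a k \<longleftrightarrow> t_p a p dvd k"
proof -
  let ?t = "t_p a p"
  have t: "?t > 0" "p dvd qk a ?t"
    using LeastI_ex[OF ex_dvd_qk[OF assms]] unfolding t_p_def by blast+
  have mult: "p dvd qk a (?t * j)" for j
    using t(2) by (induction j) (simp_all add: qk_add)
  have "p dvd qk a k \<longleftrightarrow> p dvd qk a (k mod ?t)"
    using qk_add[of a "k mod ?t" "?t * (k div ?t)"] mult[of "k div ?t"]
    by (metis add.commute div_mult_mod_eq mult.commute dvd_add_left_iff dvd_mult)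
  also have "\<dots> \<longleftrightarrow> k mod ?t = 0"
  proof
    assume *: "p dvd qk a (k mod ?t)"
    have "k mod ?t < ?t" using t(1) by simp
    then have "\<not> (0 < k mod ?t \<and> p dvd qk a (k mod ?t))"
      by (rule not_less_Least[of _ "\<lambda>k. 0 < k \<and> p dvd qk a k", folded t_p_def])
    with * show "k mod ?t = 0" by simp
  qed simp
  finally show ?thesis by (simp add: dvd_eq_mod_eq_0)
qed

section \<open>The ball in the regular tree\<close>

text \<open>These are the edges leading away from the root: a reduced word may be continued by any
  letter other than its last one.\<close>

definition letters :: "nat \<Rightarrow> nat list \<Rightarrow> nat set" where
  "letters d u = (if u = [] then {..<d} else {..<d} - {last u})"

definition children :: "nat \<Rightarrow> nat \<Rightarrow> nat list \<Rightarrow> nat list set" where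
  "children d n u = (if length u < n then (\<lambda>i. u @ [i]) ` letters d u else {})"

lemma finite_letters [simp]: "finite (letters d u)"
  by (simp add: letters_def)

lemma finite_children [simp]: "finite (children d n u)"
  by (simp add: children_def)

lemma Nil_in_tree_ball [simp]: "[] \<in> tree_ball d n"
  by (simp add: tree_ball_def)

lemma snoc_in_tree_ball_iff:
  "u @ [i] \<in> tree_ball d n \<longleftrightarrow> u \<in> tree_ball d n \<and> length u < n \<and> i \<in> letters d u"
proof -
  have "(\<forall>j. Suc j < length (u @ [i]) \<longrightarrow> (u @ [i]) ! j \<noteq> (u @ [i]) ! Suc j) \<longleftrightarrow>
        (\<forall>j. Suc j < length u \<longrightarrow> u ! j \<noteq> u ! Suc j) \<and> (u \<noteq> [] \<longrightarrow> i \<noteq> last u)" (is "?l \<longleftrightarrow> ?r")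
  proof
    assume l: ?l
    have "u ! j \<noteq> u ! Suc j" if "Suc j < length u" for j
      using l[rule_format, of j] that by (simp add: nth_append)
    moreover have "i \<noteq> last u" if "u \<noteq> []"
      using l[rule_format, of "length u - 1"] that by (auto simp: nth_append last_conv_nth)
    ultimately show ?r by blast
  next
    assume r: ?r
    show ?l
    proof (intro allI impI)
      fix j assume j: "Suc j < length (u @ [i])"
      show "(u @ [i]) ! j \<noteq> (u @ [i]) ! Suc j"
      proof (cases "Suc j < length u")
        case True then show ?thesis using r by (simp add: nth_append)
      next
        case False
        then have "length u = Suc j" using j by simp
        then show ?thesis using r by (auto simp: nth_append last_conv_nth)
      qed
    qed
  qed
  then show ?thesis unfolding tree_ball_def letters_def by auto
qed

lemma finite_tree_ball: "finite (tree_ball d n)"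
  by (rule finite_subset[OF _ finite_lists_length_le[of "{..<d}" n]]) (auto simp: tree_ball_def)

lemma children_subset_tree_ball: "u \<in> tree_ball d n \<Longrightarrow> children d n u \<subseteq> tree_ball d n"
  by (auto simp: children_def snoc_in_tree_ball_iff)

lemma butlast_in_tree_ball:
  assumes "v \<in> tree_ball d n" "v \<noteq> []"
  shows "butlast v \<in> tree_ball d n" "length (butlast v) < n" "last v \<in> letters d (butlast v)"
  using assms snoc_in_tree_ball_iff[of "butlast v" "last v" d n] by simp_all

lemma last_less: "u \<in> tree_ball d n \<Longrightarrow> u \<noteq> [] \<Longrightarrow> last u < d"
  unfolding tree_ball_def using last_in_set by blast

lemma card_letters:
  "u \<in> tree_ball d n \<Longrightarrow> card (letters d u) = (if u = [] then d else d - 1)"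
  by (simp add: letters_def last_less)

lemma card_children:
  assumes "u \<in> tree_ball d n" "length u < n"
  shows "card (children d n u) = (if u = [] then d else d - 1)"
  using assms by (simp add: children_def card_image inj_on_def card_letters)

lemma sum_children:
  assumes "length u < n"
  shows "(\<Sum>c\<in>children d n u. f c) = (\<Sum>i\<in>letters d u. f (u @ [i]))"
  using assms by (simp add: children_def sum.reindex inj_on_def)

text \<open>Each word of length \<open>Suc l\<close> arises from exactly one word of length
  \<open>l\<close> by appending an admissible letter, with \<open>d\<close> choices at the root and
  \<open>d - 1\<close> elsewhere.\<close>

lemma card_sphere:
  assumes "l \<le> n"
  shows "card {u \<in> tree_ball d n. length u = l} = (if l = 0 then 1 else d * (d - 1) ^ (l - 1))"
  using assms
proof (induction l)
  case 0
  have "{u \<in> tree_ball d n. length u = 0} = {[]}" by auto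
  then show ?case by simp
next
  case (Suc l)
  let ?S = "{u \<in> tree_ball d n. length u = l}"
  have "{u \<in> tree_ball d n. length u = Suc l} = (\<lambda>(u, i). u @ [i]) ` Sigma ?S (letters d)"
  proof (intro equalityI subsetI)
    fix v assume v: "v \<in> {u \<in> tree_ball d n. length u = Suc l}"
    then have "v \<noteq> []" by auto
    moreover from this have "v = butlast v @ [last v]" by simp
    ultimately show "v \<in> (\<lambda>(u, i). u @ [i]) ` Sigma ?S (letters d)"
      using v butlast_in_tree_ball[of v d n] by (intro image_eqI[of _ _ "(butlast v, last v)"]) auto
  qed (use Suc.prems in \<open>auto simp: snoc_in_tree_ball_iff\<close>)
  moreover have "inj_on (\<lambda>(u, i). u @ [i]) (Sigma ?S (letters d))"
    by (auto simp: inj_on_def)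
  ultimately have "card {u \<in> tree_ball d n. length u = Suc l} = (\<Sum>u\<in>?S. card (letters d u))"
    using finite_tree_ball by (simp add: card_image)
  also have "\<dots> = (\<Sum>u\<in>?S. if l = 0 then d else d - 1)"
    by (intro sum.cong) (auto simp: card_letters)
  also have "\<dots> = (if Suc l = 0 then 1 else d * (d - 1) ^ (Suc l - 1))"
    using Suc by (cases l) (auto simp: mult.assoc)
  finally show ?case .
qed

lemma tree_adj_iff:
  assumes "u \<in> tree_ball d n" "v \<in> tree_ball d n"
  shows "tree_adj u v \<longleftrightarrow> v \<in> children d n u \<or> (u \<noteq> [] \<and> v = butlast u)"
proof -
  have "(\<exists>i. u = v @ [i]) \<longleftrightarrow> u \<noteq> [] \<and> v = butlast u"
    by (metis append_butlast_last_id butlast_snoc snoc_eq_iff_butlast)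
  moreover have "(\<exists>i. v = u @ [i]) \<longleftrightarrow> v \<in> children d n u"
    using assms by (auto simp: children_def snoc_in_tree_ball_iff)
  ultimately show ?thesis unfolding tree_adj_def by blast
qed

section \<open>Neighbours, degrees and Laplacian vectors\<close>

text \<open>As a set rather than a vertex it makes sums over the parent empty at the root, so vertex
  relations have one uniform shape.\<close>

definition parent_set :: "nat list \<Rightarrow> nat list set" where
  "parent_set u = (if u = [] then {} else {butlast u})"

lemma length_parent: "v \<in> parent_set u \<Longrightarrow> Suc (length v) = length u"
  by (auto simp: parent_set_def split: if_splits)

lemma length_child: "v \<in> children d n u \<Longrightarrow> length v = Suc (length u)"
  by (auto simp: children_def split: if_splits)

lemma parent_children_disjoint: "parent_set u \<inter> children d n u = {}"
  using length_parent length_child by fastforce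

lemma parent_set_subset_tree_ball: "u \<in> tree_ball d n \<Longrightarrow> parent_set u \<subseteq> tree_ball d n"
  using butlast_in_tree_ball(1) by (auto simp: parent_set_def)

lemma neighbours_eq:
  assumes "u \<in> tree_ball d n"
  shows "{v \<in> tree_ball d n. v \<noteq> u \<and> tree_adj u v} = parent_set u \<union> children d n u"
proof -
  have "v \<in> parent_set u \<union> children d n u \<longleftrightarrow> v \<noteq> u \<and> tree_adj u v" if "v \<in> tree_ball d n" for v
    using length_parent[of v u] length_child[of v d n u] unfolding tree_adj_iff[OF assms that]
    by (auto simp: parent_set_def)
  then show ?thesis
    using parent_set_subset_tree_ball[OF assms] children_subset_tree_ball[OF assms] by blast
qed

lemma finite_parent_set [simp]: "finite (parent_set u)"
  by (simp add: parent_set_def)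

lemma finite_Bn_verts [simp]: "finite (Bn_verts d n)"
  by (simp add: Bn_verts_def finite_tree_ball)

lemma Some_in_Bn_verts [simp]: "Some u \<in> Bn_verts d n \<longleftrightarrow> u \<in> tree_ball d n"
  by (auto simp: Bn_verts_def)

lemma None_in_Bn_verts [simp]: "None \<in> Bn_verts d n"
  by (auto simp: Bn_verts_def)

lemma Bn_mult_commute: "Bn_mult d n x y = Bn_mult d n y x"
  by (cases x; cases y) (auto simp: tree_adj_def)

text \<open>At distance \<open>n\<close> the \<open>d - 1\<close> edges to the sink replace the
  \<open>d - 1\<close> missing children. The bound on \<open>n\<close> keeps the root off this
  boundary.\<close>

lemma mg_deg_Bn:
  assumes u: "u \<in> tree_ball d n" and dn: "d \<ge> 1" "n \<ge> 1"
  shows "mg_deg (Bn_verts d n) (Bn_mult d n) (Some u) = d"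
proof -
  have V: "Bn_verts d n - {Some u} = insert None (Some ` (tree_ball d n - {u}))"
    by (auto simp: Bn_verts_def)
  have "(\<Sum>v\<in>tree_ball d n - {u}. if tree_adj u v then 1 else 0 :: nat)
      = card {v \<in> tree_ball d n. v \<noteq> u \<and> tree_adj u v}"
    by (subst sum.inter_filter[symmetric])
       (auto simp: finite_tree_ball intro!: arg_cong[of _ _ card])
  also have "\<dots> = card (parent_set u) + card (children d n u)"
    unfolding neighbours_eq[OF u] by (rule card_Un_disjoint) (simp_all add: parent_children_disjoint)
  finally have 1: "(\<Sum>v\<in>tree_ball d n - {u}. if tree_adj u v then 1 else 0 :: nat)
      = card (parent_set u) + card (children d n u)" .
  have "mg_deg (Bn_verts d n) (Bn_mult d n) (Some u)
      = (if length u = n then d - 1 else 0) + (card (parent_set u) + card (children d n u))"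
    unfolding mg_deg_def V 1[symmetric]
    by (subst sum.insert) (auto simp: finite_tree_ball sum.reindex)
  also have "\<dots> = d"
  proof (cases "length u < n")
    case True
    then show ?thesis using dn by (simp add: card_children[OF u] parent_set_def)
  next
    case False
    then have "length u = n" using u by (simp add: tree_ball_def)
    then show ?thesis using dn by (auto simp: parent_set_def children_def)
  qed
  finally show ?thesis .
qed

lemma sum_unit_at_Some:
  assumes "finite A"
  shows "(\<Sum>c\<in>A. unit_at (Some c) y) = (case y of None \<Rightarrow> 0 | Some v \<Rightarrow> if v \<in> A then 1 else 0)"
proof (cases y)
  case (Some v)
  have "(\<Sum>c\<in>A. unit_at (Some c) y) = (\<Sum>c\<in>A. if c = v then 1 else 0)"
    by (intro sum.cong) (auto simp: unit_at_def Some)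
  then show ?thesis using assms Some by simp
qed (simp add: unit_at_def)

lemma laplace_vec_Bn:
  assumes u: "u \<in> tree_ball d n" and dn: "d \<ge> 1" "n \<ge> 1"
  shows "laplace_vec (Bn_verts d n) (Bn_mult d n) (Some u) y =
    (\<Sum>v\<in>parent_set u. unit_at (Some v) y) + (\<Sum>v\<in>children d n u. unit_at (Some v) y)
    - int d * unit_at (Some u) y + (if length u = n then int (d - 1) else 0) * unit_at None y"
proof (cases y)
  case None
  then show ?thesis by (simp add: laplace_vec_def sum_unit_at_Some unit_at_def)
next
  case (Some v)
  show ?thesis
  proof (cases "v \<in> tree_ball d n")
    case False
    then have "v \<notin> parent_set u" "v \<notin> children d n u" "v \<noteq> u"
      using u butlast_in_tree_ball(1)[OF u] children_subset_tree_ball[OF u]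
      by (auto simp: parent_set_def)
    then show ?thesis using Some False by (simp add: laplace_vec_def sum_unit_at_Some unit_at_def)
  next
    case v: True
    have *: "v \<in> parent_set u \<union> children d n u \<longleftrightarrow> v \<noteq> u \<and> tree_adj u v"
      using neighbours_eq[OF u] v by blast
    then show ?thesis using Some v parent_children_disjoint[of u d n]
      by (auto simp: laplace_vec_def sum_unit_at_Some unit_at_def mg_deg_Bn[OF u dn])
  qed
qed

text \<open>By symmetry of \<open>w\<close>, the entries that \<open>y\<close> receives from the
  other vertices add up to its degree. This later reduces the sink's vector to those of the tree
  vertices.\<close>

lemma sum_laplace_vec:
  assumes "finite V" "\<And>x y. w x y = w y x" "y \<in> V"
  shows "(\<Sum>x\<in>V. laplace_vec V w x y) = 0"
proof -
  have "(\<Sum>x\<in>V. laplace_vec V w x y) = laplace_vec V w y y + (\<Sum>x\<in>V - {y}. laplace_vec V w x y)"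
    using assms by (simp add: sum.remove)
  also have "(\<Sum>x\<in>V - {y}. laplace_vec V w x y) = (\<Sum>x\<in>V - {y}. int (w y x))"
    using assms by (intro sum.cong) (auto simp: laplace_vec_def)
  finally show ?thesis using assms(3) by (simp add: laplace_vec_def mg_deg_def)
qed

section \<open>The sandpile group of the ball\<close>

locale tree_sandpile =
  fixes a n p :: nat
  assumes a: "a \<ge> 2" and n: "n \<ge> 1" and p: "prime p"
    and p_a: "\<not> p dvd a" and p_d: "\<not> p dvd Suc a"
begin

abbreviation "d \<equiv> Suc a"
abbreviation "V \<equiv> Bn_verts d n"
abbreviation "B \<equiv> tree_ball d n"
abbreviation "L \<equiv> sandpile_lattice V (Bn_mult d n) None"
abbreviation "q k \<equiv> int (qk a k)"
abbreviation "e u \<equiv> unit_at (Some u)"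

section \<open>Relations in the sandpile group\<close>

lemma L: "int_subgroup L"
  by (rule int_subgroup_sandpile_lattice)

lemma unit_at_None_in_L: "unit_at None \<in> L"
  unfolding sandpile_lattice_def unit_at_def by (rule zspan_gen) simp

text \<open>The coordinate vector of the sink lies in \<open>L\<close>, so the sink entry can be
  subtracted from the Laplacian vector.\<close>

lemma vertex_relation:
  assumes u: "u \<in> B"
  shows "(\<lambda>y. (\<Sum>v\<in>parent_set u. e v y) + (\<Sum>v\<in>children d n u. e v y) - int d * e u y) \<in> L"
proof -
  have "laplace_vec V (Bn_mult d n) (Some u) \<in> L"
    unfolding sandpile_lattice_def using u by (intro zspan_gen) simp
  then show ?thesis
    by (rule int_subgroup_comb[OF L _ unit_at_None_in_L, of _ _ 1 "- (if length u = n then int (d - 1) else 0)"])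
       (use a n in \<open>simp add: laplace_vec_Bn[OF u]\<close>)
qed

text \<open>Induction on the height, from the leaves inwards: the relations between
  \<open>?v\<close> and its \<open>a\<close> children are summed, the sum over the children is
  eliminated with the vertex relation at \<open>?v\<close>, and \<open>qk_recurrence\<close>
  collects the coefficients.\<close>

lemma edge_relation:
  assumes "u @ [i] \<in> B"
  shows "(\<lambda>y. q (n - length u) * e u y - q (Suc (n - length u)) * e (u @ [i]) y) \<in> L"
  using assms
proof (induction "n - length u" arbitrary: u i)
  case 0
  then show ?case using snoc_in_tree_ball_iff[of u i d n] by simp
next
  case (Suc h)
  let ?v = "u @ [i]"
  have len: "length u < n" and h: "n - length ?v = h" and v: "?v \<in> B"
    using Suc.prems Suc.hyps(2) by (auto simp: snoc_in_tree_ball_iff)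
  have rel: "(\<lambda>y. e u y + (\<Sum>c\<in>children d n ?v. e c y) - int d * e ?v y) \<in> L"
    using vertex_relation[OF v] by (simp add: parent_set_def)
  show ?case
  proof (cases "length ?v < n")
    \<comment> \<open>At a leaf the vertex relation says that \<open>e u\<close> equals
      \<open>d\<close> times \<open>e ?v\<close>, which fits \<open>q 1 = 1\<close> and
      \<open>q 2 = d\<close>.\<close>
    case False
    then have "n - length u = 1" "children d n ?v = {}" using h len by (auto simp: children_def)
    then show ?thesis using rel by (simp add: qk_Suc')
  next
    case True
    have "(\<lambda>y. \<Sum>j\<in>letters d ?v. q h * e ?v y - q (Suc h) * e (?v @ [j]) y) \<in> L"
    proof (rule int_subgroup_sum[OF L])
      fix j assume "j \<in> letters d ?v"
      then have "?v @ [j] \<in> B" using v True snoc_in_tree_ball_iff by blast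
      from Suc.hyps(1)[OF h[symmetric] this]
      show "(\<lambda>y. q h * e ?v y - q (Suc h) * e (?v @ [j]) y) \<in> L" unfolding h .
    qed
    moreover have "(\<Sum>j\<in>letters d ?v. q h * e ?v y - q (Suc h) * e (?v @ [j]) y)
        = int a * q h * e ?v y - q (Suc h) * (\<Sum>c\<in>children d n ?v. e c y)" for y
      by (simp add: sum_subtractf sum_distrib_left card_letters[OF v] sum_children[OF True])
    ultimately have "(\<lambda>y. int a * q h * e ?v y - q (Suc h) * (\<Sum>c\<in>children d n ?v. e c y)) \<in> L"
      by simp
    then have "(\<lambda>y. q (Suc h) * e u y - q (Suc (Suc h)) * e ?v y) \<in> L"
    proof (rule int_subgroup_comb[OF L _ rel, of _ _ 1 "q (Suc h)"])
      fix y
      have "q (Suc (Suc h)) * e ?v y = (int d * q (Suc h) - int a * q h) * e ?v y"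
        using qk_recurrence[of a h] by simp
      then show "q (Suc h) * e u y - q (Suc (Suc h)) * e ?v y =
          1 * (int a * q h * e ?v y - q (Suc h) * (\<Sum>c\<in>children d n ?v. e c y)) +
          q (Suc h) * (e u y + (\<Sum>c\<in>children d n ?v. e c y) - int d * e ?v y)"
        by (simp add: algebra_simps)
    qed
    then show ?thesis using Suc.hyps(2) by simp
  qed
qed

text \<open>Combining the edge relations at the root with its vertex relation leaves the coefficient
  \<open>d * (q (Suc n) - q n)\<close>, which is \<open>d * a ^ n\<close>.\<close>

lemma root_relation: "(\<lambda>y. int (d * a ^ n) * e [] y) \<in> L"
proof -
  have len: "length [] < n" using n by simp
  have rel: "(\<lambda>y. (\<Sum>c\<in>children d n []. e c y) - int d * e [] y) \<in> L"
    using vertex_relation[OF Nil_in_tree_ball] by (simp add: parent_set_def)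
  have "(\<lambda>y. \<Sum>j\<in>letters d []. q n * e [] y - q (Suc n) * e ([] @ [j]) y) \<in> L"
  proof (rule int_subgroup_sum[OF L])
    fix j assume "j \<in> letters d []"
    then have "[] @ [j] \<in> B" using len Nil_in_tree_ball snoc_in_tree_ball_iff by blast
    from edge_relation[OF this]
    show "(\<lambda>y. q n * e [] y - q (Suc n) * e ([] @ [j]) y) \<in> L" by simp
  qed
  moreover have "(\<Sum>j\<in>letters d []. q n * e [] y - q (Suc n) * e ([] @ [j]) y)
      = int d * q n * e [] y - q (Suc n) * (\<Sum>c\<in>children d n []. e c y)" for y
    using card_letters[OF Nil_in_tree_ball[of d n]]
    by (simp add: sum_subtractf sum_distrib_left sum_children[OF len])
  ultimately have "(\<lambda>y. int d * q n * e [] y - q (Suc n) * (\<Sum>c\<in>children d n []. e c y)) \<in> L"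
    by simp
  then show ?thesis
    by (rule int_subgroup_comb[OF L _ rel, of _ _ "-1" "- q (Suc n)"])
       (simp add: qk_Suc algebra_simps)
qed

text \<open>Finiteness of the group spreads outwards from the root: a positive multiple of the
  vector of a child is a multiple of that of its parent.\<close>

lemma unit_at_in_torsion_over:
  assumes "v \<in> B" shows "e v \<in> torsion_over L"
  using assms
proof (induction v rule: rev_induct)
  case Nil
  have "(\<lambda>y. int (d * a ^ n) * e [] y) \<in> torsion_over L"
    using root_relation subset_torsion_over by blast
  then show ?case by (rule torsion_over_cancel[OF L]) (use a in \<open>simp only: of_nat_eq_0_iff, simp\<close>)
next
  case (snoc i u)
  have T: "int_subgroup (torsion_over L)" by (rule int_subgroup_torsion_over[OF L])
  have u: "e u \<in> torsion_over L" using snoc by (simp add: snoc_in_tree_ball_iff)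
  have "(\<lambda>y. q (n - length u) * e u y - q (Suc (n - length u)) * e (u @ [i]) y) \<in> torsion_over L"
    using edge_relation[OF snoc.prems] subset_torsion_over by blast
  then have "(\<lambda>y. q (Suc (n - length u)) * e (u @ [i]) y) \<in> torsion_over L"
    by (rule int_subgroup_comb[OF T _ u, of _ _ "-1" "q (n - length u)"]) simp
  then show ?case by (rule torsion_over_cancel[OF L]) (simp only: of_nat_eq_0_iff, simp add: qk_Suc')
qed

section \<open>Generators modulo p\<close>

text \<open>An arbitrary admissible letter, marking the child that is omitted from the generators:
  0, or 1 when 0 leads back to the parent.\<close>

definition first :: "nat list \<Rightarrow> nat" where
  "first u = (if u = [] \<or> last u \<noteq> 0 then 0 else 1)"

lemma first_in_letters: "first u \<in> letters d u"
  using a by (auto simp: first_def letters_def)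

text \<open>At these vertices the coefficient of the child in \<open>edge_relation\<close> vanishes
  modulo \<open>p\<close>, so the parent does not determine its children.\<close>

definition branching :: "nat list set" where
  "branching = {u \<in> B. length u < n \<and> p dvd qk a (Suc (n - length u))}"

definition generators :: "nat list option set" where
  "generators = (\<lambda>(u, i). Some (u @ [i])) ` (SIGMA u:branching. letters d u - {first u})"

lemma snoc_in_generators_iff:
  "Some (u @ [i]) \<in> generators \<longleftrightarrow> u \<in> branching \<and> i \<in> letters d u \<and> i \<noteq> first u"
  by (auto simp: generators_def)

lemma generators_subset: "generators \<subseteq> V"
  by (auto simp: generators_def branching_def snoc_in_tree_ball_iff)

lemma finite_generators: "finite generators"
  using generators_subset finite_Bn_verts by (rule finite_subset)

text \<open>Induction outwards from the root, which vanishes modulo \<open>p\<close> by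
  \<open>root_relation\<close>. Strong induction is used because the relation at the parent of
  \<open>v\<close> also involves its grandparent.\<close>

lemma unit_at_in_mod_gen:
  assumes "v \<in> B" shows "e v \<in> mod_gen (int p) generators L" (is "_ \<in> ?H")
  using assms
proof (induction "length v" arbitrary: v rule: less_induct)
  case less
  have H: "int_subgroup ?H" by (rule int_subgroup_mod_gen[OF L])
  have LH: "L \<subseteq> ?H" by (rule subset_mod_gen)
  have IH: "e w \<in> ?H" if "length w < length v" "w \<in> B" for w
    using less.hyps that by blast
  have coprime: "coprime (int m) (int p)" if "\<not> p dvd m" for m
    using that p prime_imp_coprime[of p m] by (simp add: coprime_commute)
  show ?case
  proof (cases v rule: rev_cases)
    case Nil
    have "\<not> p dvd d * a ^ n"
      using p p_a p_d prime_dvd_mult_iff prime_dvd_power by blast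
    then show ?thesis
      using mod_gen_cancel[OF L subsetD[OF LH root_relation] coprime] Nil by simp
  next
    case (snoc u i)
    let ?j = "n - length u"
    have u: "u \<in> B" "length u < n" "i \<in> letters d u"
      using less.prems snoc snoc_in_tree_ball_iff by blast+
    have eu: "e u \<in> ?H" using IH u(1) snoc by simp
    show ?thesis
    proof (cases "p dvd qk a (Suc ?j)")
      case False
      have "(\<lambda>y. q ?j * e u y - q (Suc ?j) * e v y) \<in> ?H"
        using edge_relation less.prems LH snoc by blast
      then have "(\<lambda>y. q (Suc ?j) * e v y) \<in> ?H"
        by (rule int_subgroup_comb[OF H _ eu, of _ _ "-1" "q ?j"]) simp
      then show ?thesis by (rule mod_gen_cancel[OF L _ coprime[OF False]])
    next
      case True
      then have br: "u \<in> branching" using u by (simp add: branching_def)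
      have gen: "e (u @ [k]) \<in> ?H" if "k \<in> letters d u" "k \<noteq> first u" for k
        using that br unit_at_mem_mod_gen[OF L finite_generators] by (simp add: snoc_in_generators_iff)
      show ?thesis
      proof (cases "i = first u")
        case False
        then show ?thesis using gen u(3) snoc by simp
      next
        \<comment> \<open>The omitted child occurs with coefficient 1 in the vertex relation at
          \<open>u\<close>, where every other term is already generated.\<close>
        case i: True
        have "(\<lambda>y. \<Sum>w\<in>parent_set u. e w y) \<in> ?H"
        proof (rule int_subgroup_sum[OF H])
          fix w assume w: "w \<in> parent_set u"
          have "length w < length v" using length_parent[OF w] snoc by simp
          then show "e w \<in> ?H" using IH w parent_set_subset_tree_ball[OF u(1)] by blast
        qed
        then have 1: "(\<lambda>y. int d * e u y - (\<Sum>w\<in>parent_set u. e w y)) \<in> ?H"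
          by (rule int_subgroup_comb[OF H eu, of _ _ "int d" "-1"]) simp
        have "(\<lambda>y. \<Sum>k\<in>letters d u - {first u}. e (u @ [k]) y) \<in> ?H"
          by (rule int_subgroup_sum[OF H]) (simp add: gen)
        then have 2: "(\<lambda>y. int d * e u y - (\<Sum>w\<in>parent_set u. e w y)
            - (\<Sum>k\<in>letters d u - {first u}. e (u @ [k]) y)) \<in> ?H"
          by (rule int_subgroup_comb[OF H 1, of _ _ 1 "-1"]) simp
        show ?thesis
        proof (rule int_subgroup_comb[OF H subsetD[OF LH vertex_relation[OF u(1)]] 2])
          fix y
          have "(\<Sum>c\<in>children d n u. e c y)
              = e v y + (\<Sum>k\<in>letters d u - {first u}. e (u @ [k]) y)"
            unfolding sum_children[OF u(2)] snoc i
            by (rule sum.remove[OF finite_letters first_in_letters])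
          then show "e v y = 1 * ((\<Sum>w\<in>parent_set u. e w y) + (\<Sum>c\<in>children d n u. e c y) - int d * e u y)
              + 1 * (int d * e u y - (\<Sum>w\<in>parent_set u. e w y)
                  - (\<Sum>k\<in>letters d u - {first u}. e (u @ [k]) y))"
            by simp
        qed
      qed
    qed
  qed
qed

section \<open>Harmonic functions modulo p\<close>

text \<open>A representative of \<open>q j / q (Suc j)\<close> modulo \<open>p\<close>: the factor
  by which a harmonic function changes from a vertex of height \<open>j\<close> to its child when
  \<open>p\<close> does not divide \<open>q (Suc j)\<close>.\<close>

definition ratio :: "nat \<Rightarrow> int" where
  "ratio j = (SOME r. int p dvd q (Suc j) * r - q j)"

lemma ratio:
  assumes "\<not> p dvd qk a (Suc j)" shows "int p dvd q (Suc j) * ratio j - q j"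
proof -
  have "coprime (q (Suc j)) (int p)"
    using assms p prime_imp_coprime[of p "qk a (Suc j)"] by (simp add: coprime_commute)
  then obtain x y where xy: "x * q (Suc j) + y * int p = 1"
    using bezout_int[of "q (Suc j)" "int p"] by (auto simp: coprime_iff_gcd_eq_1)
  have "q (Suc j) * (x * q j) - q j = (x * q (Suc j) + y * int p) * q j - q j - int p * (y * q j)"
    by (simp add: algebra_simps)
  then have "q (Suc j) * (x * q j) - q j = int p * - (y * q j)" unfolding xy by simp
  then have "\<exists>r. int p dvd q (Suc j) * r - q j" by (metis dvd_triv_left)
  then show ?thesis unfolding ratio_def by (rule someI_ex)
qed

text \<open>Solves the harmonicity equations modulo \<open>p\<close> from the root outwards. If \<open>p\<close> does not divide
  \<open>q\<^bsub>j+1\<^esub>\<close>, where \<open>j\<close> is the height of \<open>u\<close>, then the value at \<open>u\<close> forces the values at its children;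
  otherwise they can be prescribed, except that the equation at \<open>u\<close> determines the last one.\<close>

function harm :: "(nat list \<Rightarrow> int) \<Rightarrow> nat list \<Rightarrow> int" where
  "harm b v = (if v = [] then 0
     else if \<not> p dvd qk a (Suc (n - length (butlast v)))
       then ratio (n - length (butlast v)) * harm b (butlast v)
     else if last v \<noteq> first (butlast v) then b v
     else int d * harm b (butlast v)
       - (if butlast v = [] then 0 else harm b (butlast (butlast v)))
       - (\<Sum>i\<in>letters d (butlast v) - {first (butlast v)}. b (butlast v @ [i])))"
  by pat_completeness auto
termination by (relation "measure (\<lambda>(b, v). length v)") auto

declare harm.simps [simp del]

text \<open>The value 0 is forced modulo \<open>p\<close>: by \<open>root_relation\<close>,
  \<open>d * a ^ n\<close> annihilates the root, and this factor is prime to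
  \<open>p\<close>.\<close>

lemma harm_Nil [simp]: "harm b [] = 0"
  by (simp add: harm.simps)

lemma harm_snoc:
  "harm b (u @ [i]) =
     (if \<not> p dvd qk a (Suc (n - length u)) then ratio (n - length u) * harm b u
      else if i \<noteq> first u then b (u @ [i])
      else int d * harm b u - (\<Sum>v\<in>parent_set u. harm b v)
        - (\<Sum>i\<in>letters d u - {first u}. b (u @ [i])))"
  by (subst harm.simps) (simp add: parent_set_def)

text \<open>If \<open>p\<close> divides \<open>q ?j\<close>, then \<open>ratio ?j\<close> is 0
  modulo \<open>p\<close>, so the value vanishes on passing from the parent \<open>w\<close> to
  \<open>u\<close>. Hence values at children of branching vertices can be prescribed without
  violating the edge relations.\<close>

lemma harm_dvd:
  assumes "u \<in> B" "p dvd qk a (Suc (n - length u))"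
  shows "int p dvd harm b u"
proof (cases u rule: rev_cases)
  case (snoc w i)
  let ?j = "n - length w"
  have "length w < n" using assms(1) snoc snoc_in_tree_ball_iff by blast
  then have "Suc (n - length u) = ?j" using snoc by simp
  then have j: "p dvd qk a ?j" using assms(2) by simp
  then have not: "\<not> p dvd qk a (Suc ?j)" by (rule not_dvd_qk_Suc[OF p])
  have "int p dvd q (Suc ?j) * ratio ?j - q ?j" by (rule ratio[OF not])
  then have "int p dvd q (Suc ?j) * ratio ?j" using j
    by (metis diff_add_cancel dvd_add of_nat_dvd_iff)
  then have "int p dvd ratio ?j" using not p by (simp add: prime_dvd_mult_iff)
  then show ?thesis using not snoc by (simp add: harm_snoc)
qed simp

text \<open>The counterpart of \<open>edge_relation\<close> for functions. At a branching vertex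
  both terms vanish modulo \<open>p\<close>, the first by \<open>harm_dvd\<close>; elsewhere the
  definition of \<open>ratio\<close> gives it.\<close>

lemma harm_edge:
  assumes "u @ [i] \<in> B"
  shows "int p dvd q (n - length u) * harm b u - q (Suc (n - length u)) * harm b (u @ [i])"
proof (cases "p dvd qk a (Suc (n - length u))")
  case True
  then have "int p dvd harm b u" using harm_dvd assms snoc_in_tree_ball_iff by blast
  then show ?thesis using True by (intro dvd_diff) auto
next
  case False
  let ?j = "n - length u"
  have "q ?j * harm b u - q (Suc ?j) * harm b (u @ [i]) = - harm b u * (q (Suc ?j) * ratio ?j - q ?j)"
    using False by (simp add: harm_snoc algebra_simps)
  then show ?thesis using ratio[OF False] by simp
qed

lemma harm_harmonic:
  assumes u: "u \<in> B"
  shows "int p dvd (\<Sum>v\<in>parent_set u. harm b v) + (\<Sum>v\<in>children d n u. harm b v) - int d * harm b u"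
proof (cases "length u < n")
  case False
  then have len: "length u = n" using u by (simp add: tree_ball_def)
  then have "u \<noteq> []" using n by auto
  then obtain w i where w: "u = w @ [i]" by (metis rev_exhaust)
  have "n - length w = 1" using len w by simp
  then have "int p dvd harm b w - int d * harm b u"
    using harm_edge[of w i b] u w by (simp add: qk_Suc')
  then show ?thesis using w len by (simp add: parent_set_def children_def)
next
  case len: True
  let ?j = "n - length u"
  show ?thesis
  proof (cases "p dvd qk a (Suc ?j)")
    case True
    have "(\<Sum>v\<in>children d n u. harm b v)
        = harm b (u @ [first u]) + (\<Sum>i\<in>letters d u - {first u}. harm b (u @ [i]))"
      unfolding sum_children[OF len] by (rule sum.remove[OF finite_letters first_in_letters])
    also have "(\<Sum>i\<in>letters d u - {first u}. harm b (u @ [i])) = (\<Sum>i\<in>letters d u - {first u}. b (u @ [i]))"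
      using True by (intro sum.cong) (auto simp: harm_snoc)
    finally show ?thesis using True by (simp add: harm_snoc)
  next
    case False
    have ch: "(\<Sum>v\<in>children d n u. harm b v) = int (card (letters d u)) * (ratio ?j * harm b u)"
      unfolding sum_children[OF len] using False by (simp add: harm_snoc)
    show ?thesis
    proof (cases u rule: rev_cases)
      case Nil
      then show ?thesis unfolding ch by (simp add: parent_set_def)
    next
      case (snoc w i)
      \<comment> \<open>Multiplied by \<open>q (Suc ?j)\<close>, the expression \<open>?X\<close>
        becomes a combination of the edge congruence above \<open>u\<close> and the congruence for
        \<open>ratio\<close> below it; the factor is then cancelled modulo \<open>p\<close>.\<close>
      let ?X = "harm b w + int a * (ratio ?j * harm b u) - int d * harm b u"
      have "n - length w = Suc ?j" using snoc len by simp
      then have 1: "int p dvd q (Suc ?j) * harm b w - q (Suc (Suc ?j)) * harm b u"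
        using harm_edge[of w i b] u snoc by simp
      have "q (Suc (Suc ?j)) * harm b u = (int d * q (Suc ?j) - int a * q ?j) * harm b u"
        using qk_recurrence[of a ?j] by simp
      then have "q (Suc ?j) * ?X = (q (Suc ?j) * harm b w - q (Suc (Suc ?j)) * harm b u)
          + int a * harm b u * (q (Suc ?j) * ratio ?j - q ?j)"
        by (simp add: algebra_simps)
      then have "int p dvd q (Suc ?j) * ?X"
        using 1 ratio[OF False] by (metis dvd_add dvd_mult)
      then have "int p dvd ?X" using False p by (simp add: prime_dvd_mult_iff)
      moreover have "card (letters d u) = a" using snoc card_letters[OF u] by simp
      ultimately show ?thesis unfolding ch using snoc by (simp add: parent_set_def)
    qed
  qed
qed

lemma harm_generators: "Some v \<in> generators \<Longrightarrow> harm b v = b v"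
  by (auto simp: generators_def branching_def harm_snoc split: if_splits)

text \<open>The functional extends \<open>harm\<close> by 0 at the sink, so it kills the sink's
  coordinate vector; harmonicity handles the Laplacian vectors of tree vertices.\<close>

lemma dual_functional:
  fixes b :: "nat list option \<Rightarrow> int"
  shows "\<exists>\<phi> :: nat list option \<Rightarrow> int.
    (\<forall>x\<in>L. int p dvd (\<Sum>y\<in>V. \<phi> y * x y)) \<and> (\<forall>g\<in>generators. \<phi> g = b g)"
proof -
  define \<phi> where "\<phi> = (\<lambda>y. case y of None \<Rightarrow> 0 | Some v \<Rightarrow> harm (\<lambda>v. b (Some v)) v)"
  have \<phi>_sum: "(\<Sum>y\<in>V. \<phi> y * (\<Sum>v\<in>A. e v y)) = (\<Sum>v\<in>A. \<phi> (Some v))" if "A \<subseteq> B" for A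
  proof -
    have "(\<Sum>y\<in>V. \<phi> y * (\<Sum>v\<in>A. e v y)) = (\<Sum>v\<in>A. \<Sum>y\<in>V. \<phi> y * e v y)"
      unfolding sum_distrib_left by (rule sum.swap)
    also have "\<dots> = (\<Sum>v\<in>A. \<phi> (Some v))"
      using that by (intro sum.cong sum_mult_unit_at) auto
    finally show ?thesis .
  qed
  have None: "(\<Sum>y\<in>V. \<phi> y * unit_at None y) = 0"
    by (simp add: sum_mult_unit_at) (simp add: \<phi>_def)
  have Some: "int p dvd (\<Sum>y\<in>V. \<phi> y * laplace_vec V (Bn_mult d n) (Some u) y)" if u: "u \<in> B" for u
  proof -
    let ?c = "if length u = n then int (d - 1) else 0"
    have "(\<Sum>y\<in>V. \<phi> y * laplace_vec V (Bn_mult d n) (Some u) y)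
      = (\<Sum>y\<in>V. \<phi> y * (\<Sum>v\<in>parent_set u. e v y)) + (\<Sum>y\<in>V. \<phi> y * (\<Sum>v\<in>children d n u. e v y))
        - int d * (\<Sum>y\<in>V. \<phi> y * e u y) + ?c * (\<Sum>y\<in>V. \<phi> y * unit_at None y)"
      unfolding sum_distrib_left[of "int d"] sum_distrib_left[of ?c]
        sum.distrib[symmetric] sum_subtractf[symmetric]
      using n by (intro sum.cong) (simp_all add: laplace_vec_Bn[OF u] algebra_simps)
    also have "\<dots> = (\<Sum>v\<in>parent_set u. \<phi> (Some v)) + (\<Sum>v\<in>children d n u. \<phi> (Some v)) - int d * \<phi> (Some u)"
      using u parent_set_subset_tree_ball[OF u] children_subset_tree_ball[OF u]
      by (simp only: \<phi>_sum None sum_mult_unit_at[OF finite_Bn_verts] Some_in_Bn_verts)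
    finally show ?thesis using harm_harmonic[OF u] by (simp add: \<phi>_def)
  qed
  \<comment> \<open>All Laplacian vectors together sum to zero on \<open>V\<close>, so the condition
    at the sink follows from those at the tree vertices.\<close>
  have sink: "int p dvd (\<Sum>y\<in>V. \<phi> y * laplace_vec V (Bn_mult d n) None y)"
  proof -
    have "(\<Sum>x\<in>V. \<Sum>y\<in>V. \<phi> y * laplace_vec V (Bn_mult d n) x y)
        = (\<Sum>y\<in>V. \<phi> y * (\<Sum>x\<in>V. laplace_vec V (Bn_mult d n) x y))"
      unfolding sum_distrib_left by (rule sum.swap)
    also have "\<dots> = 0"
      by (intro sum.neutral) (simp add: sum_laplace_vec[OF finite_Bn_verts Bn_mult_commute])
    finally have "(\<Sum>y\<in>V. \<phi> y * laplace_vec V (Bn_mult d n) None y)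
        = - (\<Sum>x\<in>V - {None}. \<Sum>y\<in>V. \<phi> y * laplace_vec V (Bn_mult d n) x y)"
      by (simp add: sum.remove[of V None])
    moreover have "int p dvd (\<Sum>x\<in>V - {None}. \<Sum>y\<in>V. \<phi> y * laplace_vec V (Bn_mult d n) x y)"
    proof (rule dvd_sum)
      fix x assume x: "x \<in> V - {None}"
      then obtain u where "x = Some u" by auto
      then show "int p dvd (\<Sum>y\<in>V. \<phi> y * laplace_vec V (Bn_mult d n) x y)" using x Some by simp
    qed
    ultimately show ?thesis by simp
  qed
  have "int p dvd (\<Sum>y\<in>V. \<phi> y * x y)" if "x \<in> L" for x
  proof (rule sandpile_lattice_pairing[OF _ _ that])
    show "int p dvd (\<Sum>y\<in>V. \<phi> y * laplace_vec V (Bn_mult d n) v y)" if "v \<in> V" for v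
      using that Some sink by (cases v) auto
  qed (simp add: None)
  moreover have "\<phi> g = b g" if "g \<in> generators" for g
  proof (cases g)
    case None
    then show ?thesis using that by (auto simp: generators_def)
  next
    case (Some v)
    then show ?thesis using that harm_generators by (simp add: \<phi>_def)
  qed
  ultimately show ?thesis by blast
qed

lemma sylow_rank_eq: "sylow_rank V (Bn_mult d n) None p = card generators"
proof (rule sylow_rank_eq_card)
  show "unit_at v \<in> torsion_over L" if "v \<in> V" for v
    using that unit_at_in_torsion_over unit_at_None_in_L subset_torsion_over[of L] by (cases v) auto
  show "unit_at v \<in> mod_gen (int p) generators L" if "v \<in> V" for v
    using that unit_at_in_mod_gen unit_at_None_in_L subset_mod_gen[of L] by (cases v) auto
qed (use p generators_subset dual_functional in auto)

section \<open>Counting the generators\<close>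

text \<open>Each branching vertex yields one generator fewer than it has children. Branching depends
  only on the length, so the count is grouped by spheres.\<close>

lemma card_generators_sum:
  "card generators = (\<Sum>l | l < n \<and> p dvd qk a (Suc (n - l)). if l = 0 then a else d * (a - 1) * a ^ (l - 1))"
proof -
  let ?S = "{l. l < n \<and> p dvd qk a (Suc (n - l))}"
  let ?B = "\<lambda>l. {u \<in> B. length u = l}"
  have "inj_on (\<lambda>(u, i). Some (u @ [i])) (SIGMA u:branching. letters d u - {first u})"
    by (auto simp: inj_on_def)
  moreover have "finite branching"
    using finite_tree_ball[of d n] by (simp add: branching_def)
  ultimately have "card generators = (\<Sum>u\<in>branching. card (letters d u - {first u}))"
    unfolding generators_def by (simp add: card_image)
  also have "\<dots> = (\<Sum>u\<in>branching. if u = [] then a else a - 1)"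
    using first_in_letters by (intro sum.cong) (auto simp: branching_def card_letters)
  also have "branching = (\<Union>l\<in>?S. ?B l)" by (auto simp: branching_def)
  also have "(\<Sum>u\<in>(\<Union>l\<in>?S. ?B l). if u = [] then a else a - 1)
      = (\<Sum>l\<in>?S. \<Sum>u\<in>?B l. if u = [] then a else a - 1)"
    by (rule sum.UNION_disjoint) (use finite_tree_ball in auto)
  also have "\<dots> = (\<Sum>l\<in>?S. if l = 0 then a else d * (a - 1) * a ^ (l - 1))"
  proof (rule sum.cong[OF refl])
    fix l assume "l \<in> ?S"
    then have l: "l \<le> n" by simp
    have "(\<Sum>u\<in>?B l. if u = [] then a else a - 1) = (\<Sum>u\<in>?B l. if l = 0 then a else a - 1)"
      by (intro sum.cong) auto
    then show "(\<Sum>u\<in>?B l. if u = [] then a else a - 1) = (if l = 0 then a else d * (a - 1) * a ^ (l - 1))"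
      using card_sphere[OF l, of d] by (cases "l = 0") (simp_all add: mult_ac del: mult_Suc mult_Suc_right)
  qed
  finally show ?thesis .
qed

text \<open>With \<open>l = m + 1\<close> the condition on \<open>l\<close> becomes divisibility of
  \<open>n - m\<close> by \<open>t_p a p\<close>; the remaining index \<open>l = 0\<close>, the
  root, gives the extra term.\<close>

lemma card_generators:
  "card generators = d * (a - 1) * (\<Sum>m | m < n \<and> m mod t_p a p = n mod t_p a p. a ^ m)
     + (if (n + 1) mod t_p a p = 0 then a else 0)"
proof -
  let ?t = "t_p a p"
  let ?S = "{l. l < n \<and> p dvd qk a (Suc (n - l))}"
  let ?T = "{m. m < n \<and> m mod ?t = n mod ?t}"
  have "coprime a p" using p p_a prime_imp_coprime coprime_commute by blast
  note t = dvd_qk_iff_t_p_dvd[OF this a prime_gt_0_nat[OF p]]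
  \<comment> \<open>Since \<open>q 1 = 1\<close>, the period is not 1. This excludes
    \<open>m = n - 1\<close>, so the ranges \<open>m < n\<close> and \<open>Suc m < n\<close> select
    the same indices.\<close>
  have t1: "?t \<noteq> 1" using t[of 1] p by auto
  have ST: "Suc m \<in> ?S \<longleftrightarrow> m \<in> ?T" for m
  proof -
    have "m < n \<Longrightarrow> m mod ?t = n mod ?t \<longleftrightarrow> ?t dvd n - m"
      using mod_eq_dvd_iff_nat[of m n ?t] by auto
    moreover have "m < n \<Longrightarrow> ?t dvd n - m \<Longrightarrow> Suc m < n"
      using t1 by (metis Suc_lessI diff_Suc_Suc nat_dvd_1_iff_1 One_nat_def Suc_diff_le diff_self_eq_0 le_refl)
    ultimately show ?thesis unfolding t by (auto simp: Suc_diff_Suc)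
  qed
  have S0: "?S - {0} = Suc ` ?T"
  proof (intro equalityI subsetI)
    fix l assume "l \<in> ?S - {0}"
    then obtain m where "l = Suc m" "Suc m \<in> ?S" by (cases l) auto
    then show "l \<in> Suc ` ?T" using ST by blast
  qed (use ST in blast)
  have zero: "0 \<in> ?S \<longleftrightarrow> (n + 1) mod ?t = 0"
    using n t[of "Suc n"] by (simp add: dvd_eq_mod_eq_0)
  let ?f = "\<lambda>l. if l = 0 then a else d * (a - 1) * a ^ (l - 1)"
  have "sum ?f ?S = (if 0 \<in> ?S then ?f 0 else 0) + sum ?f (?S - {0})"
  proof (cases "0 \<in> ?S")
    case True
    have "finite ?S" by simp
    from sum.remove[OF this True, of ?f] True show ?thesis by (simp only: if_True)
  next
    case False
    then have "?S - {0} = ?S" by blast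
    then show ?thesis using False by (simp only: if_False add_0)
  qed
  also have "sum ?f (?S - {0}) = d * (a - 1) * (\<Sum>m\<in>?T. a ^ m)"
    unfolding S0 by (simp add: sum.reindex sum_distrib_left)
  finally show ?thesis unfolding card_generators_sum zero by simp
qed

end

theorem mainTheorem8:
  fixes d n p :: nat
  assumes "d \<ge> 3" and "n \<ge> 1" and "prime p" and "\<not> p dvd d * (d - 1)"
  shows "sylow_rank (Bn_verts d n) (Bn_mult d n) None p =
     d * (d - 2) * (\<Sum>m\<in>{m. m < n \<and> m mod t_p (d - 1) p = n mod t_p (d - 1) p}. (d - 1) ^ m)
     + (if (n + 1) mod t_p (d - 1) p = 0 then d - 1 else 0)"
proof -
  interpret tree_sandpile "d - 1" n p
    using assms by unfold_locales (auto simp: dvd_mult dvd_mult2)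
  have "Suc (d - 1) = d" "d - 1 - 1 = d - 2" using assms(1) by simp_all
  then show ?thesis using sylow_rank_eq card_generators by simp
qed

end
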